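(* Let $\mathcal{D}=\mathcal{D}_{2,n,q}$ and suppose $(\mathcal{D},U,W)$ is a BEL-configuration in $V(2n,q)$. Then $(\mathcal{D},U^{\epsilon},W)$ is also a BEL-configuration.
   Context: Represent $V(2n,q)$ as $(\mathbb{F}_{q^n})^2$, regarded as a $2n$-dimensional $\mathbb{F}_q$-space, and let $\mathcal{D}_{2,n,q}$ be the $n$-spread consisting of all one-dimensional $\mathbb{F}_{q^n}$-subspaces of $(\mathbb{F}_{q^n})^2$. For a subset $A$, $\mathcal{B}(A)$ is the set of elements of $\mathcal{D}_{2,n,q}$ containing a nonzero vector of $A$. A BEL-configuration $(\mathcal{D}_{2,n,q},U,W)$ in $V(2n,q)$ consists of $\mathcal{D}_{2,n,q}$ and $\mathbb{F}_q$-subspaces $U,W$, both of dimension $n$, with $\mathcal{B}(U)\cap\mathcal{B}(W)=\emptyset$. For an $\mathbb{F}_q$-subspace $M$ of $V(2n,q)$, $M^\epsilon=\{v\in V(2n,q):b_\epsilon(u,v)=0\ \forall u\in M\}$, where $b_\epsilon((a,b),(c,d))=\mathrm{tr}(ad-bc)$ and $\mathrm{tr}$ is the trace from $\mathbb{F}_{q^n}$ to $\mathbb{F}_q$. *)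

theory Defs
  imports
    "HOL-Library.Cardinality"
    "HOL-Library.Product_Plus"
    "HOL-Computational_Algebra.Computational_Algebra"
begin

text \<open>
  The fields \<open>\<F>\<^sub>q\<close> and \<open>\<F>\<^bsub>q^n\<^esub>\<close> are types \<open>'k\<close> and \<open>'a\<close>; the inclusion of the former in the
  latter is a ring homomorphism \<open>emb\<close>, which is injective because \<open>'k\<close> is a field.
  The ambient space \<open>V(2n,q)\<close> is \<open>'a \<times> 'a\<close>.
\<close>

locale finite_field_extension =
  fixes emb :: "'k::finite_field \<Rightarrow> 'a::finite_field" and q n :: nat
  assumes emb_add: "emb (c + d) = emb c + emb d"
    and emb_mult: "emb (c * d) = emb c * emb d"
    and emb_one: "emb 1 = 1"
    and card_base: "CARD('k) = q"
    and card_ext: "CARD('a) = q ^ n"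

text \<open>
  Scalar multiplication on pairs along a homomorphism of fields: \<open>emb\<close> gives the
  \<open>\<F>\<^sub>q\<close>-structure, the identity gives the \<open>\<F>\<^bsub>q^n\<^esub>\<close>-structure.
\<close>

definition pair_scale :: "('k \<Rightarrow> 'a) \<Rightarrow> 'k \<Rightarrow> 'a \<times> 'a \<Rightarrow> 'a::finite_field \<times> 'a" where
  "pair_scale h c v = (h c * fst v, h c * snd v)"

definition desarguesian_spread :: "('a::finite_field \<times> 'a) set set" where
  "desarguesian_spread =
     {S. module.subspace (pair_scale id) S \<and> vector_space.dim (pair_scale id) S = 1}"

definition spread_elements :: "('a::finite_field \<times> 'a) set \<Rightarrow> ('a \<times> 'a) set set" where
  "spread_elements A = {S \<in> desarguesian_spread. \<exists>v\<in>A. v \<noteq> 0 \<and> v \<in> S}"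

definition bel_configuration ::
    "('k::finite_field \<Rightarrow> 'a::finite_field) \<Rightarrow> nat \<Rightarrow>
     ('a \<times> 'a) set set \<Rightarrow> ('a \<times> 'a) set \<Rightarrow> ('a \<times> 'a) set \<Rightarrow> bool" where
  "bel_configuration emb n D U W \<longleftrightarrow>
     D = desarguesian_spread \<and>
     module.subspace (pair_scale emb) U \<and> vector_space.dim (pair_scale emb) U = n \<and>
     module.subspace (pair_scale emb) W \<and> vector_space.dim (pair_scale emb) W = n \<and>
     spread_elements U \<inter> spread_elements W = {}"

text \<open>
  The trace is the sum of the conjugates \<open>x, x^q, \<dots>, x^(q^(n-1))\<close>, pulled back to \<open>'k\<close>;
  \<open>emb_field_trace\<close> below shows that this sum does lie in the image of \<open>emb\<close>.
\<close>

definition field_trace ::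
    "('k::finite_field \<Rightarrow> 'a::finite_field) \<Rightarrow> nat \<Rightarrow> 'a \<Rightarrow> 'k" where
  "field_trace emb n x = inv emb (\<Sum>i<n. x ^ (CARD('k) ^ i))"

definition eps_form ::
    "('k::finite_field \<Rightarrow> 'a::finite_field) \<Rightarrow> nat \<Rightarrow> 'a \<times> 'a \<Rightarrow> 'a \<times> 'a \<Rightarrow> 'k" where
  "eps_form emb n v w = field_trace emb n (fst v * snd w - snd v * fst w)"

definition eps_perp ::
    "('k::finite_field \<Rightarrow> 'a::finite_field) \<Rightarrow> nat \<Rightarrow> ('a \<times> 'a) set \<Rightarrow> ('a \<times> 'a) set" where
  "eps_perp emb n M = {v. \<forall>u\<in>M. eps_form emb n u v = 0}"

lemma vector_space_pair_scale_id: "vector_space (pair_scale (id :: 'a \<Rightarrow> 'a::finite_field))"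
  by unfold_locales (auto simp: pair_scale_def algebra_simps)

context finite_field_extension
begin

lemma vector_space_pair_scale: "vector_space (pair_scale emb)"
  by unfold_locales (auto simp: pair_scale_def emb_add emb_mult emb_one algebra_simps)

lemma emb_zero: "emb 0 = 0"
  by (metis add.right_neutral add_left_cancel emb_add)

lemma emb_power: "emb (c ^ k) = emb c ^ k"
  by (induction k) (simp_all add: emb_one emb_mult)

lemma inj_emb: "inj emb"
proof (rule injI)
  fix c d assume eq: "emb c = emb d"
  have "emb (c - d) = 0"
    using emb_add[of "c - d" d] eq by simp
  moreover have "emb (c - d) \<noteq> 0" if "c \<noteq> d"
    using emb_mult[of "c - d" "inverse (c - d)"] that by (auto simp: emb_one)
  ultimately show "c = d" by blast
qed

lemma q_gt_1: "q > 1"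
proof -
  have "card {0, 1 :: 'k} \<le> CARD('k)" by (rule card_mono) auto
  then show ?thesis by (simp add: card_base)
qed

lemma card_range_emb: "card (range emb) = q"
  using inj_emb by (simp add: card_image card_base)

lemma emb_power_q: "emb c ^ q = emb c"
  by (metis emb_power finite_field_power_card_eq_same card_base)

lemma range_emb_eq: "range emb = {x :: 'a. x ^ q = x}"
proof (rule card_seteq)
  let ?p = "monom 1 q - monom 1 1 :: 'a poly"
  have "coeff ?p q = 1" using q_gt_1 by simp
  then have "?p \<noteq> 0" by (metis coeff_0 zero_neq_one)
  moreover have "degree ?p \<le> q"
    by (rule degree_diff_le) (use q_gt_1 in \<open>auto simp: degree_monom_eq\<close>)
  ultimately have "card {x. poly ?p x = 0} \<le> q"
    using card_poly_roots_bound[of ?p] by linarith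
  then show "card {x :: 'a. x ^ q = x} \<le> card (range emb)"
    by (simp add: poly_monom card_range_emb)
qed (auto simp: emb_power_q)

lemma power_q_add_1: "(x + 1) ^ q = x ^ q + (1 :: 'a)"
proof -
  define p :: "'a poly" where "p = [:1, 1:] ^ q - monom 1 q - 1"
  have deg: "degree ([:1, 1:] ^ q :: 'a poly) = q"
    by (simp add: degree_power_eq)
  have lc: "coeff ([:1, 1:] ^ q :: 'a poly) q = 1"
    using lead_coeff_power[of "[:1, 1:] :: 'a poly" q] deg by simp
  have "degree p \<le> q"
    unfolding p_def by (intro degree_diff_le) (simp_all add: deg degree_monom_eq)
  moreover have "coeff p q = 0"
    using q_gt_1 by (simp add: p_def lc)
  ultimately have lt: "degree p < q" if "p \<noteq> 0"
    using that by (metis leading_coeff_0_iff order_le_less)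
  have "poly p y = 0" if "y \<in> range emb" for y
  proof -
    obtain c where c: "y = emb c" using \<open>y \<in> range emb\<close> by blast
    have "(1 + y) ^ q = 1 + y" using emb_power_q[of "1 + c"] by (simp add: c emb_add emb_one)
    then show ?thesis by (simp add: p_def poly_monom c emb_power_q)
  qed
  then have "card (range emb) \<le> card {y. poly p y = 0}"
    by (intro card_mono) auto
  then have "p = 0"
    using card_poly_roots_bound[of p] lt by (force simp: card_range_emb)
  then have "poly p x = 0" by simp
  then show ?thesis by (simp add: p_def poly_monom add.commute algebra_simps)
qed

lemma power_q_add: "(x + y) ^ q = x ^ q + (y :: 'a) ^ q"
proof (cases "y = 0")
  case True
  then show ?thesis using q_gt_1 by simp
next
  case False
  then have "x + y = y * (x / y + 1)" by (simp add: field_simps)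
  then have "(x + y) ^ q = (y * (x / y + 1)) ^ q" by (rule arg_cong)
  also have "\<dots> = y ^ q * ((x / y) ^ q + 1)" by (simp add: power_mult_distrib power_q_add_1)
  also have "\<dots> = x ^ q + y ^ q" using False by (simp add: field_simps)
  finally show ?thesis .
qed

lemma power_q_sum: "(\<Sum>i\<in>I. f i) ^ q = (\<Sum>i\<in>I. f i ^ q)" for f :: "'i \<Rightarrow> 'a"
  by (induction I rule: infinite_finite_induct) (use q_gt_1 in \<open>simp_all add: power_q_add\<close>)

lemma emb_field_trace: "emb (field_trace emb n x) = (\<Sum>i<n. x ^ (q ^ i))"
proof -
  let ?s = "\<Sum>i<n. x ^ (q ^ i)"
  have "x ^ (q ^ n) = x"
    using finite_field_power_card_eq_same[of x] by (simp add: card_ext)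
  moreover have "?s ^ q = (\<Sum>i<n. x ^ (q ^ Suc i))"
    by (simp add: power_q_sum mult.commute flip: power_mult)
  moreover have "(\<Sum>i<n. x ^ (q ^ Suc i)) + x = ?s + x ^ (q ^ n)"
    using sum.lessThan_Suc_shift[of "\<lambda>i. x ^ (q ^ i)" n] by (simp add: add.commute)
  ultimately have "?s ^ q = ?s" by simp
  then have "?s \<in> range emb" by (simp add: range_emb_eq)
  then show ?thesis by (simp add: field_trace_def card_base f_inv_into_f)
qed

end

end

theory Submission
  imports Defs
begin

text \<open>
  Write \<open>det(v, w) = v\<^sub>1 w\<^sub>2 - v\<^sub>2 w\<^sub>1\<close>, so that \<open>b\<^sub>\<epsilon> = tr \<circ> det\<close>.
  Two nonzero vectors lie in a common spread element iff their determinant vanishes, so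
  \<open>\<B>(U) \<inter> \<B>(W) = \<emptyset>\<close> says that \<open>det(u, w) \<noteq> 0\<close> for all nonzero \<open>u \<in> U\<close>, \<open>w \<in> W\<close>.

  Fix a nonzero \<open>w \<in> W\<close>; the vectors that share a spread element with \<open>w\<close> are its nonzero
  \<open>\<F>\<^bsub>q^n\<^esub>\<close>-multiples. The \<open>\<F>\<^sub>q\<close>-linear map \<open>u \<mapsto> det(u, w)\<close> is injective on \<open>U\<close>, and
  \<open>U\<close> has as many elements as \<open>\<F>\<^bsub>q^n\<^esub>\<close>, so it maps \<open>U\<close> onto \<open>\<F>\<^bsub>q^n\<^esub>\<close>. If now
  \<open>\<lambda> w \<in> U\<^sup>\<epsilon>\<close>, then \<open>tr(\<lambda> det(u, w)) = 0\<close> for all \<open>u \<in> U\<close>, that is,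
  \<open>tr(\<lambda> x) = 0\<close> for all \<open>x\<close>; since the trace is not identically zero, \<open>\<lambda> = 0\<close>. Hence
  \<open>\<B>(U\<^sup>\<epsilon>)\<close> and \<open>\<B>(W)\<close> are disjoint (\<open>pair_det_eps_perp_nonzero\<close>).

  It remains to see that \<open>U\<^sup>\<epsilon>\<close> has \<open>q^n\<close> elements. It has at least that many, because it
  is cut out of a space of size \<open>q^(2n)\<close> by the \<open>n\<close> linear conditions given by a basis of
  \<open>U\<close>. It has at most that many, because the disjointness just shown makes
  \<open>v \<mapsto> det(v, w)\<close> injective on \<open>U\<^sup>\<epsilon>\<close> as well (\<open>dim_eps_perp\<close>).
\<close>

section \<open>Counting in spaces over finite fields\<close>

lemma (in vector_space) card_span_independent:
  assumes "finite B" "independent B"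
  shows "card (span B) = CARD('a) ^ card B"
  using assms
proof (induction B)
  case empty
  then show ?case by simp
next
  case (insert b B)
  have ind: "independent B" and b: "b \<notin> span B"
    using insert.prems insert.hyps by (auto simp: independent_insert)
  have "bij_betw (\<lambda>(c, s). scale c b + s) (UNIV \<times> span B) (span (insert b B))"
    unfolding bij_betw_def
  proof
    show "inj_on (\<lambda>(c, s). scale c b + s) (UNIV \<times> span B)"
    proof (rule inj_onI, clarsimp)
      fix c s d t
      assume s: "s \<in> span B" and t: "t \<in> span B" and eq: "scale c b + s = scale d b + t"
      have "scale (c - d) b = t - s"
        using eq by (simp add: scale_left_diff_distrib algebra_simps)
      then have "scale (c - d) b \<in> span B" using s t by (simp add: span_diff)
      then have "b \<in> span B" if "c \<noteq> d"
        using that span_scale[of "scale (c - d) b" B "inverse (c - d)"] by simp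
      then have "c = d" using b by blast
      then show "c = d \<and> s = t" using eq by simp
    qed
    show "(\<lambda>(c, s). scale c b + s) ` (UNIV \<times> span B) = span (insert b B)"
    proof (intro equalityI subsetI)
      fix x assume "x \<in> (\<lambda>(c, s). scale c b + s) ` (UNIV \<times> span B)"
      then obtain c s where "x = scale c b + s" "s \<in> span B" by auto
      then show "x \<in> span (insert b B)"
        by (auto simp: span_insert intro!: exI[of _ c])
    next
      fix x assume "x \<in> span (insert b B)"
      then obtain c where "x - scale c b \<in> span B" by (auto simp: span_insert)
      then show "x \<in> (\<lambda>(c, s). scale c b + s) ` (UNIV \<times> span B)"
        by (intro image_eqI[of _ _ "(c, x - scale c b)"]) auto
    qed
  qed
  then have "card (span (insert b B)) = CARD('a) * card (span B)"
    by (metis bij_betw_same_card card_cartesian_product)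
  then show ?case using insert.IH[OF ind] insert.hyps by simp
qed

lemma (in vector_space) card_subspace:
  assumes "subspace S" "finite S"
  shows "card S = CARD('a) ^ dim S"
proof -
  obtain B where B: "B \<subseteq> S" "independent B" "S \<subseteq> span B" "card B = dim S"
    by (rule basis_exists)
  then have "span B = S" using assms(1) span_subspace by blast
  then show ?thesis
    using card_span_independent[of B] B assms(2) finite_subset by metis
qed

text \<open>
  A single linear condition divides the size of a group by at most the number of its values:
  the fibres are cosets of the kernel.
\<close>

lemma card_le_card_range_times_kernel:
  fixes f :: "'v::ab_group_add \<Rightarrow> 'k::{finite, ab_group_add}"
  assumes "finite S" and diff: "\<And>x y. x \<in> S \<Longrightarrow> y \<in> S \<Longrightarrow> x - y \<in> S"
    and f_diff: "\<And>x y. f (x - y) = f x - f y"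
  shows "card S \<le> CARD('k) * card {x \<in> S. f x = 0}"
proof -
  \<comment> \<open>An element is determined by its value and its offset from a fixed element with that value.\<close>
  define rep where "rep c = inv_into S f c" for c
  have rep: "rep (f x) \<in> S" "f (rep (f x)) = f x" if "x \<in> S" for x
    using that by (simp_all add: rep_def inv_into_into f_inv_into_f)
  have "card S \<le> card ((UNIV :: 'k set) \<times> {x \<in> S. f x = 0})"
  proof (rule card_inj_on_le)
    show "inj_on (\<lambda>x. (f x, x - rep (f x))) S"
      by (rule inj_onI) auto
    show "(\<lambda>x. (f x, x - rep (f x))) ` S \<subseteq> UNIV \<times> {x \<in> S. f x = 0}"
      using rep by (auto simp: f_diff intro: diff)
    show "finite ((UNIV :: 'k set) \<times> {x \<in> S. f x = 0})"
      using assms(1) by simp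
  qed
  then show ?thesis by (simp add: card_cartesian_product)
qed

section \<open>The determinant and the spread\<close>

definition pair_det :: "'a::field \<times> 'a \<Rightarrow> 'a \<times> 'a \<Rightarrow> 'a" where
  "pair_det v w = fst v * snd w - snd v * fst w"

lemma pair_det_diff_left: "pair_det (v - v') w = pair_det v w - pair_det v' w"
  by (simp add: pair_det_def algebra_simps)

lemma pair_det_diff_right: "pair_det v (w - w') = pair_det v w - pair_det v w'"
  by (simp add: pair_det_def algebra_simps)

lemma pair_det_scale_right: "pair_det v (pair_scale h c w) = h c * pair_det v w"
  by (simp add: pair_det_def pair_scale_def algebra_simps)

lemma pair_det_eq_0_imp_scale:
  assumes "w \<noteq> 0" "pair_det v w = 0"
  obtains l where "v = pair_scale id l w"
proof (cases "fst w = 0")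
  case True
  then have "snd w \<noteq> 0" using assms(1) by (auto simp: prod_eq_iff)
  then have "v = pair_scale id (snd v / snd w) w"
    using True assms(2) by (auto simp: pair_det_def pair_scale_def prod_eq_iff)
  then show ?thesis by (rule that)
next
  case False
  then have "v = pair_scale id (fst v / fst w) w"
    using assms(2) by (auto simp: pair_det_def pair_scale_def prod_eq_iff field_simps)
  then show ?thesis by (rule that)
qed

lemma inj_on_pair_det:
  assumes diff: "\<And>x y. x \<in> S \<Longrightarrow> y \<in> S \<Longrightarrow> x - y \<in> S"
    and nz: "\<And>v. v \<in> S \<Longrightarrow> v \<noteq> 0 \<Longrightarrow> pair_det v w \<noteq> 0"
  shows "inj_on (\<lambda>v. pair_det v w) S"
proof (rule inj_onI)
  fix x y assume "x \<in> S" "y \<in> S" "pair_det x w = pair_det y w"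
  then show "x = y"
    using nz[OF diff, of x y] by (auto simp: pair_det_diff_left)
qed

text \<open>
  The spread elements are the lines \<open>\<F>\<^bsub>q^n\<^esub> b\<close>, so two nonzero vectors share one exactly
  when they are proportional.
\<close>

lemma spread_elements_disjoint_iff:
  "spread_elements A \<inter> spread_elements B = {} \<longleftrightarrow>
     (\<forall>v\<in>A. \<forall>w\<in>B. v \<noteq> 0 \<longrightarrow> w \<noteq> 0 \<longrightarrow> pair_det v w \<noteq> 0)"
proof -
  interpret L: vector_space "pair_scale (id :: 'a \<Rightarrow> 'a)"
    by (rule vector_space_pair_scale_id)
  have dependent: "pair_det v w = 0"
    if S: "S \<in> desarguesian_spread" "v \<in> S" "w \<in> S" for S and v w :: "'a \<times> 'a"
  proof -
    have "L.subspace S" "L.dim S = 1"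
      using S(1) by (auto simp: desarguesian_spread_def)
    moreover obtain C where "C \<subseteq> S" "L.independent C" "S \<subseteq> L.span C" "card C = L.dim S"
      by (rule L.basis_exists)
    ultimately have "card C = 1" "S \<subseteq> L.span C" by simp_all
    then obtain b where "S \<subseteq> L.span {b}"
      by (metis card_1_singletonE)
    then obtain c d where "v = pair_scale id c b" "w = pair_scale id d b"
      using S(2,3) unfolding L.span_singleton by blast
    then show ?thesis by (simp add: pair_det_def pair_scale_def)
  qed
  have common: "\<exists>S\<in>desarguesian_spread. v \<in> S \<and> w \<in> S"
    if parallel: "w \<noteq> 0" "pair_det v w = 0" for v w :: "'a \<times> 'a"
  proof -
    obtain l where "v = pair_scale id l w"
      by (rule pair_det_eq_0_imp_scale[OF parallel])
    then have "v \<in> L.span {w}" by (auto simp: L.span_singleton)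
    moreover have "L.span {w} \<in> desarguesian_spread"
      using parallel(1) L.dim_span_eq_card_independent[of "{w}"]
      by (auto simp: desarguesian_spread_def L.subspace_span)
    ultimately show ?thesis using L.span_base[of w "{w}"] by blast
  qed
  show ?thesis
  proof (intro iffI ballI impI notI)
    fix v w :: "'a \<times> 'a"
    assume disj: "spread_elements A \<inter> spread_elements B = {}"
      and "v \<in> A" "w \<in> B" "v \<noteq> 0" "w \<noteq> 0" "pair_det v w = 0"
    moreover from this obtain S where "S \<in> desarguesian_spread" "v \<in> S" "w \<in> S"
      using common by blast
    ultimately have "S \<in> spread_elements A \<inter> spread_elements B"
      by (auto simp: spread_elements_def)
    with disj show False by blast
  next
    assume nz: "\<forall>v\<in>A. \<forall>w\<in>B. v \<noteq> 0 \<longrightarrow> w \<noteq> 0 \<longrightarrow> pair_det v w \<noteq> 0"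
    show "spread_elements A \<inter> spread_elements B = {}"
    proof (rule equals0I)
      fix S assume "S \<in> spread_elements A \<inter> spread_elements B"
      then obtain v w where "S \<in> desarguesian_spread" "v \<in> A" "v \<noteq> 0" "v \<in> S"
          "w \<in> B" "w \<noteq> 0" "w \<in> S"
        unfolding spread_elements_def by blast
      then show False using nz dependent by blast
    qed
  qed
qed

section \<open>The trace form and orthogonal spaces\<close>

context finite_field_extension
begin

interpretation V: vector_space "pair_scale emb"
  by (rule vector_space_pair_scale)

lemma n_pos: "n > 0"
proof -
  have "card {0, 1 :: 'a} \<le> CARD('a)" by (rule card_mono) auto
  then show ?thesis by (cases n) (auto simp: card_ext)
qed

lemma power_q_power_diff: "(x - y :: 'a) ^ (q ^ i) = x ^ (q ^ i) - y ^ (q ^ i)"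
proof (induction i arbitrary: x y)
  case (Suc i)
  have "(x - y) ^ q = x ^ q - y ^ q"
    using power_q_add[of "x - y" y] by simp
  then show ?case using Suc by (simp add: power_mult)
qed simp

lemma field_trace_diff:
  "field_trace emb n (x - y) = field_trace emb n x - field_trace emb n y"
proof -
  have "emb (c - d) = emb c - emb d" for c d
    using emb_add[of "c - d" d] by (simp add: algebra_simps)
  then have "emb (field_trace emb n (x - y)) = emb (field_trace emb n x - field_trace emb n y)"
    by (simp add: emb_field_trace power_q_power_diff sum_subtractf)
  then show ?thesis by (rule injD[OF inj_emb])
qed

lemma field_trace_scale: "field_trace emb n (emb c * x) = c * field_trace emb n x"
proof -
  have "emb c ^ (q ^ i) = emb c" for i
    by (induction i) (simp_all add: power_mult emb_power_q)
  then have "emb (field_trace emb n (emb c * x)) = emb (c * field_trace emb n x)"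
    by (simp add: emb_field_trace emb_mult power_mult_distrib sum_distrib_left)
  then show ?thesis by (rule injD[OF inj_emb])
qed

text \<open>
  The trace is a polynomial function of degree \<open>q^(n-1)\<close>, too small to vanish at all
  \<open>q^n\<close> elements.
\<close>

lemma ex_field_trace_nonzero: "\<exists>x. field_trace emb n x \<noteq> 0"
proof (rule ccontr)
  assume "\<not> ?thesis"
  then have zero: "(\<Sum>i<n. x ^ (q ^ i)) = 0" for x :: 'a
    using emb_field_trace[of x] by (simp add: emb_zero)
  define p :: "'a poly" where "p = (\<Sum>i<n. monom 1 (q ^ i))"
  have "poly p x = 0" for x
    using zero by (simp add: p_def poly_sum poly_monom)
  moreover have "degree p \<le> q ^ (n - 1)"
    unfolding p_def
  proof (rule degree_sum_le)
    fix i assume "i \<in> {..<n}"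
    then show "degree (monom (1 :: 'a) (q ^ i)) \<le> q ^ (n - 1)"
      using q_gt_1 by (auto simp: degree_monom_eq intro: power_increasing)
  qed simp
  moreover have "q ^ (n - 1) < q ^ n"
    using q_gt_1 n_pos by simp
  moreover have "coeff p (q ^ (n - 1)) = (\<Sum>i<n. if i = n - 1 then 1 else 0)"
    unfolding p_def coeff_sum
    by (intro sum.cong) (use q_gt_1 in \<open>auto simp: power_inject_exp\<close>)
  then have "p \<noteq> 0" using n_pos by auto
  ultimately show False
    using card_poly_roots_bound[of p] by (simp add: card_ext)
qed

lemma eps_form_eq: "eps_form emb n v w = field_trace emb n (pair_det v w)"
  by (simp add: eps_form_def pair_det_def)

lemma subspace_eps_perp: "V.subspace (eps_perp emb n M)"
proof (rule V.subspaceI)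
  have "v - w \<in> eps_perp emb n M" if "v \<in> eps_perp emb n M" "w \<in> eps_perp emb n M" for v w
    using that by (simp add: eps_perp_def eps_form_eq pair_det_diff_right field_trace_diff)
  moreover show zero: "0 \<in> eps_perp emb n M"
    using field_trace_diff[of 0 0] by (simp add: eps_perp_def eps_form_eq pair_det_def)
  ultimately show "v + w \<in> eps_perp emb n M"
    if "v \<in> eps_perp emb n M" "w \<in> eps_perp emb n M" for v w
    using that by (metis diff_0 diff_minus_eq_add)
qed (simp add: eps_perp_def eps_form_eq pair_det_scale_right field_trace_scale)

lemma eps_form_skew: "eps_form emb n w v = - eps_form emb n v w"
proof -
  have "pair_det w v = 0 - pair_det v w" by (simp add: pair_det_def)
  then show ?thesis
    using field_trace_diff[of 0 0] by (simp add: eps_form_eq field_trace_diff del: diff_0)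
qed

text \<open>
  Orthogonality is symmetric, so \<open>v\<close> is orthogonal to \<open>B\<close> iff \<open>B\<close> lies in the subspace
  orthogonal to \<open>v\<close>; that subspace then contains the span too.
\<close>

lemma eps_perp_span: "eps_perp emb n (V.span B) = eps_perp emb n B"
proof
  show "eps_perp emb n (V.span B) \<subseteq> eps_perp emb n B"
    by (auto simp: eps_perp_def V.span_base)
  show "eps_perp emb n B \<subseteq> eps_perp emb n (V.span B)"
  proof
    fix v assume "v \<in> eps_perp emb n B"
    then have "B \<subseteq> eps_perp emb n {v}"
      by (auto simp: eps_perp_def eps_form_skew[of v])
    then have "V.span B \<subseteq> eps_perp emb n {v}"
      by (rule V.span_minimal) (rule subspace_eps_perp)
    then show "v \<in> eps_perp emb n (V.span B)"
      by (auto simp: eps_perp_def eps_form_skew[of v])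
  qed
qed

text \<open>
  Each vector of \<open>B\<close> imposes one linear condition with \<open>q\<close> possible values, so it costs at most
  a factor \<open>q\<close>.
\<close>

lemma card_eps_perp_ge:
  assumes "finite B"
  shows "q ^ (2 * n) \<le> q ^ card B * card (eps_perp emb n B)"
  using assms
proof (induction B)
  case empty
  have "card (UNIV :: ('a \<times> 'a) set) = q ^ (2 * n)"
    by (simp add: card_ext mult_2 power_add)
  then show ?case by (simp add: eps_perp_def)
next
  case (insert b B)
  have "card (eps_perp emb n B) \<le> q * card {v \<in> eps_perp emb n B. eps_form emb n b v = 0}"
    unfolding card_base[symmetric]
    by (rule card_le_card_range_times_kernel)
       (auto simp: eps_form_eq pair_det_diff_right field_trace_diff
          intro: V.subspace_diff[OF subspace_eps_perp])
  also have "{v \<in> eps_perp emb n B. eps_form emb n b v = 0} = eps_perp emb n (insert b B)"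
    by (auto simp: eps_perp_def)
  finally have "q ^ card B * card (eps_perp emb n B)
      \<le> q ^ card (insert b B) * card (eps_perp emb n (insert b B))"
    using insert.hyps by (simp add: mult.assoc mult.left_commute)
  with insert.IH show ?case by linarith
qed

text \<open>
  Since \<open>u \<mapsto> det(u, w)\<close> is injective on \<open>U\<close>, it maps \<open>U\<close> onto \<open>\<F>\<^bsub>q^n\<^esub>\<close> by counting, so a
  nonzero multiple \<open>\<lambda> w\<close> orthogonal to \<open>U\<close> would give \<open>tr(\<lambda> x) = 0\<close> for every \<open>x\<close>.
\<close>

lemma pair_det_eps_perp_nonzero:
  assumes U: "V.subspace U" "V.dim U = n"
    and nz: "\<And>u. u \<in> U \<Longrightarrow> u \<noteq> 0 \<Longrightarrow> pair_det u w \<noteq> 0"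
    and w: "w \<noteq> 0" and v: "v \<in> eps_perp emb n U" "v \<noteq> 0"
  shows "pair_det v w \<noteq> 0"
proof
  assume "pair_det v w = 0"
  then obtain l where l: "v = pair_scale id l w"
    using pair_det_eq_0_imp_scale w by blast
  then have "l \<noteq> 0" using v(2) by (auto simp: pair_scale_def zero_prod_def)
  have "inj_on (\<lambda>u. pair_det u w) U"
    by (rule inj_on_pair_det) (auto intro: V.subspace_diff[OF U(1)] dest: nz)
  then have "card ((\<lambda>u. pair_det u w) ` U) = CARD('a)"
    using V.card_subspace[of U] U by (simp add: card_image card_base card_ext)
  then have onto: "(\<lambda>u. pair_det u w) ` U = UNIV"
    by (intro card_subset_eq) auto
  have "field_trace emb n x = 0" for x
  proof -
    obtain u where "u \<in> U" "x / l = pair_det u w" using onto by (metis UNIV_I imageE)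
    then have "field_trace emb n (l * (x / l)) = 0"
      using v(1) by (simp add: eps_perp_def eps_form_eq l pair_det_scale_right)
    then show ?thesis using \<open>l \<noteq> 0\<close> by simp
  qed
  then show False using ex_field_trace_nonzero by blast
qed

text \<open>
  The \<open>n\<close> conditions from a basis of \<open>U\<close> leave at least \<open>q^n\<close> vectors, and \<open>v \<mapsto> det(v, w)\<close>
  embeds \<open>U\<^sup>\<epsilon>\<close> into \<open>\<F>\<^bsub>q^n\<^esub>\<close>, which leaves at most \<open>q^n\<close>.
\<close>

lemma dim_eps_perp:
  assumes U: "V.subspace U" "V.dim U = n"
    and nz: "\<And>v. v \<in> eps_perp emb n U \<Longrightarrow> v \<noteq> 0 \<Longrightarrow> pair_det v w \<noteq> 0"
  shows "V.dim (eps_perp emb n U) = n"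
proof -
  have "inj_on (\<lambda>v. pair_det v w) (eps_perp emb n U)"
    by (rule inj_on_pair_det) (auto intro: V.subspace_diff[OF subspace_eps_perp] dest: nz)
  then have "card (eps_perp emb n U) \<le> q ^ n"
    using card_inj_on_le[of _ _ "UNIV :: 'a set"] by (simp add: card_ext)
  moreover have "q ^ n \<le> card (eps_perp emb n U)"
  proof -
    obtain B where B: "B \<subseteq> U" "V.independent B" "U \<subseteq> V.span B" "card B = V.dim U"
      by (rule V.basis_exists)
    then have "eps_perp emb n U = eps_perp emb n B"
      using U(1) V.span_subspace eps_perp_span by metis
    then have "q ^ n * q ^ n \<le> q ^ n * card (eps_perp emb n U)"
      using card_eps_perp_ge[of B] B(4) U(2) by (simp add: mult_2 power_add)
    then show ?thesis using q_gt_1 by simp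
  qed
  moreover have "card (eps_perp emb n U) = q ^ V.dim (eps_perp emb n U)"
    using V.card_subspace[OF subspace_eps_perp] by (simp add: card_base)
  ultimately show ?thesis using q_gt_1 by simp
qed

lemma bel_configuration_eps_perp:
  assumes "bel_configuration emb n D U W"
  shows "bel_configuration emb n D (eps_perp emb n U) W"
proof -
  have U: "V.subspace U" "V.dim U = n" and W: "V.subspace W" "V.dim W = n"
    and disj: "\<And>u w. u \<in> U \<Longrightarrow> w \<in> W \<Longrightarrow> u \<noteq> 0 \<Longrightarrow> w \<noteq> 0 \<Longrightarrow> pair_det u w \<noteq> 0"
    using assms by (auto simp: bel_configuration_def spread_elements_disjoint_iff)
  have disj': "pair_det v w \<noteq> 0"
    if "v \<in> eps_perp emb n U" "w \<in> W" "v \<noteq> 0" "w \<noteq> 0" for v w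
    by (rule pair_det_eps_perp_nonzero[OF U _ that(4,1,3)]) (rule disj[OF _ that(2) _ that(4)])
  \<comment> \<open>The dimension count needs a nonzero vector of \<open>W\<close>, which \<open>n > 0\<close> provides.\<close>
  have "\<not> W \<subseteq> {0}"
  proof
    assume "W \<subseteq> {0}"
    then have "V.dim W \<le> card ({} :: ('a \<times> 'a) set)"
      by (intro V.dim_le_card) simp_all
    then show False using W(2) n_pos by simp
  qed
  then obtain w where "w \<in> W" "w \<noteq> 0" by blast
  then have "V.dim (eps_perp emb n U) = n"
    using dim_eps_perp[OF U disj'] by blast
  then show ?thesis
    using assms disj' subspace_eps_perp
    by (auto simp: bel_configuration_def spread_elements_disjoint_iff)
qed

end

theorem theorem12:
  fixes emb :: "'k::finite_field \<Rightarrow> 'a::finite_field"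
    and q n :: nat
    and D :: "('a \<times> 'a) set set"
    and U W :: "('a \<times> 'a) set"
  assumes "finite_field_extension emb q n"
    and "D = desarguesian_spread"
    and "bel_configuration emb n D U W"
  shows "bel_configuration emb n D (eps_perp emb n U) W"
  using finite_field_extension.bel_configuration_eps_perp[OF assms(1) assms(3)] .

end
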